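(* Let $\alpha(v),\beta(v),\gamma(v)$ and $P_0(v)$ be functions analytic in $|v|\le 1$, and define $P_n(v)$ for $n\ge1$ by \[ P_n(v)=(\alpha(v)n+\gamma(v))P_{n-1}(v)+\beta(v)(1-v)P_{n-1}'(v). \] Assume that $[v^k]P_n(v)\ge 0$ and $P_n(v)\not\equiv 0$ for all $k,n\ge0$, and that $\alpha:=\alpha(1)>0$. Write $\beta:=\beta(1)$ and define \[ \mu:=\frac{\alpha'(1)}{\alpha+\beta},\qquad \sigma^2:=\mu+\frac{\alpha''(1)-2\mu\beta'(1)-\alpha\mu^2}{\alpha+2\beta}. \] If $\alpha+2\beta>0$ and $\sigma^2>0$, then the random variables $X_n$ defined by $\mathbb{P}(X_n=k)=[v^k]P_n(v)/P_n(1)$ satisfy $\mathbb{E}(X_n)\sim\mu n$, $\mathbb{V}(X_n)\sim\sigma^2 n$, and \[ \sup_{x\in\mathbb{R}}\left|\mathbb{P}\left(\frac{X_n-\mu n}{\sigma\sqrt{n}}\le x\right)-\Phi(x)\right|\to 0, \] where $\Phi$ is the standard normal distribution function.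
   Context: $[v^k]P_n(v)$ denotes the coefficient of $v^k$ in the Taylor expansion of $P_n$ at $0$. Under the hypotheses $P_n(1)>0$ for all $n$, so $X_n$ is a well-defined random variable. *)

theory Defs
  imports
    "HOL-Complex_Analysis.Complex_Analysis"
    "HOL-Probability.Probability"
    "HOL-Library.Complex_Order"
    "HOL-Library.Landau_Symbols"
begin

text \<open>
  The coefficient functions are total functions on the complex plane that are only assumed to be
  analytic on the closed unit disc (that is, on some open neighbourhood of it). The values
  of the sequence below are therefore meaningful only near the closed disc.
\<close>

primrec eulerian_seq ::
  "(complex \<Rightarrow> complex) \<Rightarrow> (complex \<Rightarrow> complex) \<Rightarrow> (complex \<Rightarrow> complex) \<Rightarrow> (complex \<Rightarrow> complex)
    \<Rightarrow> nat \<Rightarrow> complex \<Rightarrow> complex"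
where
  "eulerian_seq \<alpha> \<beta> \<gamma> P\<^sub>0 0 = P\<^sub>0"
| "eulerian_seq \<alpha> \<beta> \<gamma> P\<^sub>0 (Suc n) =
    (\<lambda>v. (\<alpha> v * of_nat (Suc n) + \<gamma> v) * eulerian_seq \<alpha> \<beta> \<gamma> P\<^sub>0 n v
         + \<beta> v * (1 - v) * deriv (eulerian_seq \<alpha> \<beta> \<gamma> P\<^sub>0 n) v)"

text \<open>
  Both parameters are defined as complex numbers, because the coefficient functions are
  complex-valued. Inequalities such as \<open>0 < z\<close> for complex \<open>z\<close> refer to the order in which
  \<open>0 < z\<close> means that \<open>z\<close> is real and positive.
\<close>

definition eulerian_mu :: "(complex \<Rightarrow> complex) \<Rightarrow> (complex \<Rightarrow> complex) \<Rightarrow> complex" where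
  "eulerian_mu \<alpha> \<beta> = deriv \<alpha> 1 / (\<alpha> 1 + \<beta> 1)"

definition eulerian_sigma2 :: "(complex \<Rightarrow> complex) \<Rightarrow> (complex \<Rightarrow> complex) \<Rightarrow> complex" where
  "eulerian_sigma2 \<alpha> \<beta> =
    eulerian_mu \<alpha> \<beta>
    + ((deriv ^^ 2) \<alpha> 1 - 2 * eulerian_mu \<alpha> \<beta> * deriv \<beta> 1 - \<alpha> 1 * (eulerian_mu \<alpha> \<beta>)\<^sup>2)
      / (\<alpha> 1 + 2 * \<beta> 1)"

end

theory Submission
  imports Defs "HOL-Real_Asymp.Real_Asymp"
begin

text \<open>
  Method of moments. In the variable \<open>v = exp s\<close> the centred moment generating functions
  \<open>exp (-\<mu> n s) P\<^sub>n(exp s) / P\<^sub>n(1)\<close> again satisfy a first-order recurrence, so their \<open>k\<close>-th Taylor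
  coefficients at \<open>0\<close> satisfy \<open>x (n + 1) = (1 - k \<beta> / (\<alpha> n) + ...) x n + y n\<close>, where \<open>y n\<close> only involves
  lower coefficients. The choice of \<open>\<mu>\<close> cancels the leading contribution of the coefficient of index
  \<open>k - 1\<close>, so \<open>y n\<close> is dominated by the one of index \<open>k - 2\<close>, and by induction the \<open>k\<close>-th coefficient
  divided by \<open>n powr (k / 2)\<close> converges to the one of \<open>exp (\<sigma>\<^sup>2 s\<^sup>2 / 2)\<close>; the homogeneous
  solution \<open>n powr (-k \<beta> / \<alpha>)\<close> is negligible precisely because \<open>\<alpha> + 2 \<beta> > 0\<close>.
  Convergence of all moments to those of the normal law gives the limit law. That \<open>\<mu>\<close> is real follows
  from the case \<open>k = 1\<close>, and \<open>\<mu> > 0\<close> since nonnegative variables have no centred normal limit.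
\<close>

section \<open>Linear recurrences with asymptotically harmonic damping\<close>

text \<open>Since \<open>1 - c / n \<le> exp (- c / n) \<le> (n / (n + 1)) powr c\<close>, the
  excess of \<open>u\<close> over any fixed positive level is eventually bounded by a multiple of
  \<open>n powr (-c)\<close>, once the forcing term is absorbed into the level.\<close>

lemma contraction_tendsto_0:
  fixes u e :: "nat \<Rightarrow> real"
  assumes c: "0 < c" and nonneg: "\<And>n. 0 \<le> u n" and e: "e \<longlonglongrightarrow> 0"
    and step: "eventually (\<lambda>n. u (Suc n) \<le> (1 - c / real n) * u n + e n / real n) sequentially"
  shows "u \<longlonglongrightarrow> 0"
proof (rule tendstoI)
  fix \<epsilon> :: real assume "0 < \<epsilon>"
  define \<delta> where "\<delta> = \<epsilon> / 2"
  define w where "w n = max (u n - \<delta>) 0" for n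
  have \<delta>: "0 < \<delta>" using \<open>0 < \<epsilon>\<close> by (simp add: \<delta>_def)
  have "eventually (\<lambda>n. e n < c * \<delta>) sequentially"
    using order_tendstoD(2)[OF e] c \<delta> by simp
  moreover have "eventually (\<lambda>n. real n > c) sequentially" by real_asymp
  ultimately have "eventually (\<lambda>n. n > 0 \<and> real n > c \<and> e n < c * \<delta> \<and>
      u (Suc n) \<le> (1 - c / real n) * u n + e n / real n) sequentially"
    using step eventually_gt_at_top[of 0] by eventually_elim auto
  then obtain N where N: "\<And>n. n \<ge> N \<Longrightarrow> n > 0 \<and> real n > c \<and> e n < c * \<delta> \<and>
      u (Suc n) \<le> (1 - c / real n) * u n + e n / real n"
    by (auto simp: eventually_sequentially)
  have dec: "w (Suc n) * real (Suc n) powr c \<le> w n * real n powr c" if "n \<ge> N" for n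
  proof -
    have n: "n > 0" "real n > c" "e n < c * \<delta>" "u (Suc n) \<le> (1 - c / real n) * u n + e n / real n"
      using N[OF that] by auto
    have q: "0 \<le> 1 - c / real n" using n c by (simp add: field_simps)
    \<comment> \<open>The level \<open>\<delta>\<close> is a fixed point of the recurrence with
      forcing \<open>c * \<delta>\<close>, so subtracting it removes the forcing term.\<close>
    have "e n / real n \<le> c * \<delta> / real n" using n by (simp add: divide_right_mono)
    with n(4) have "u (Suc n) - \<delta> \<le> (1 - c / real n) * (u n - \<delta>)"
      by (simp add: algebra_simps diff_divide_distrib)
    also have "\<dots> \<le> (1 - c / real n) * w n"
      using q by (intro mult_left_mono) (auto simp: w_def)
    finally have "w (Suc n) \<le> (1 - c / real n) * w n"
      using q by (auto simp: w_def)
    also have "\<dots> \<le> exp (- c / real n) * w n"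
      using exp_ge_add_one_self[of "- c / real n"] by (intro mult_right_mono) (auto simp: w_def)
    also have "\<dots> \<le> exp (- c * ln (real (Suc n) / real n)) * w n"
    proof -
      have "ln (real (Suc n) / real n) \<le> 1 / real n"
        using ln_add_one_self_le_self[of "1 / real n"] n by (simp add: field_simps)
      then have "c * ln (real (Suc n) / real n) \<le> c * (1 / real n)"
        using c by (intro mult_left_mono) auto
      then show ?thesis by (intro mult_right_mono) (auto simp: w_def)
    qed
    also have "exp (- c * ln (real (Suc n) / real n)) = real n powr c / real (Suc n) powr c"
      using n by (simp add: powr_def ln_div exp_diff [symmetric] algebra_simps)
    finally show ?thesis by (simp add: field_simps)
  qed
  have bound: "w n * real n powr c \<le> w N * real N powr c" if "n \<ge> N" for n
    using that by (induction n rule: dec_induct) (use dec order_trans in blast)+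
  have "(\<lambda>n. w N * real N powr c * real n powr (-c)) \<longlonglongrightarrow> 0"
    using c by real_asymp
  then have "eventually (\<lambda>n. w N * real N powr c * real n powr (-c) < \<delta>) sequentially"
    using \<delta> by (rule order_tendstoD)
  then show "eventually (\<lambda>n. dist (u n) 0 < \<epsilon>) sequentially"
    using eventually_ge_at_top[of N]
  proof eventually_elim
    case (elim n)
    have "0 < n" using N elim by auto
    have "w n = (w n * real n powr c) * real n powr (-c)"
      using \<open>0 < n\<close> by (simp add: powr_minus field_simps)
    also have "\<dots> \<le> w N * real N powr c * real n powr (-c)"
      using bound[of n] elim by (intro mult_right_mono) auto
    finally have "w n < \<delta>" using elim by simp
    then show ?case using nonneg[of n] by (simp add: w_def \<delta>_def max_def split: if_splits)
  qed
qed

text \<open>Write \<open>x n = n powr r * (z + u n)\<close> with \<open>z\<close> the expected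
  limit. The quotient of consecutive powers adds \<open>r\<close> to the damping \<open>L\<close>,
  so \<open>u\<close> is contracted by a factor \<open>1 - k n / n\<close> with \<open>k n\<close>
  tending to \<open>L + r\<close>, up to a forcing of order \<open>o(1) / n\<close>.\<close>

lemma linear_recurrence_asymptotics:
  fixes x y :: "nat \<Rightarrow> 'a :: real_normed_vector" and l :: "nat \<Rightarrow> real"
  assumes rec: "\<And>n. x (Suc n) = (1 - l n) *\<^sub>R x n + y n"
    and l: "(\<lambda>n. real n * l n) \<longlonglongrightarrow> L"
    and y: "(\<lambda>n. y n /\<^sub>R real n powr (r - 1)) \<longlonglongrightarrow> w"
    and pos: "0 < L + r"
  shows "(\<lambda>n. x n /\<^sub>R real n powr r) \<longlonglongrightarrow> w /\<^sub>R (L + r)"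
proof -
  define z where "z = w /\<^sub>R (L + r)"
  define q where "q n = (real n / real (Suc n)) powr r" for n
  define k where "k n = real n * (1 - (1 - l n) * q n)" for n
  define v where "v n = q n *\<^sub>R (y n /\<^sub>R real n powr (r - 1))" for n
  define u where "u n = x n /\<^sub>R real n powr r - z" for n
  have q: "q \<longlonglongrightarrow> 1" unfolding q_def by real_asymp
  have "(\<lambda>n. real n * (1 - q n)) \<longlonglongrightarrow> r" unfolding q_def by real_asymp
  from tendsto_add[OF tendsto_mult[OF l q] this] have k: "k \<longlonglongrightarrow> L + r"
    by (simp add: k_def[abs_def] algebra_simps)
  have v: "v \<longlonglongrightarrow> w" unfolding v_def using tendsto_scaleR[OF q y] by simp
  have eq: "u (Suc n) = (1 - k n / real n) *\<^sub>R u n + (v n - k n *\<^sub>R z) /\<^sub>R real n" if "n > 0" for n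
  proof -
    have *: "q n / real n powr r = 1 / real (Suc n) powr r"
      using that by (simp add: q_def powr_divide)
    have "x (Suc n) /\<^sub>R real (Suc n) powr r = ((1 - l n) * (q n / real n powr r)) *\<^sub>R x n
        + (q n / real n powr r) *\<^sub>R y n"
      unfolding * rec by (simp add: scaleR_add_right mult.commute divide_inverse)
    also have "\<dots> = (1 - k n / real n) *\<^sub>R (x n /\<^sub>R real n powr r) + v n /\<^sub>R real n"
      using that by (simp add: k_def v_def powr_diff field_simps)
    finally show ?thesis
      by (simp add: u_def scaleR_diff_right scaleR_diff_left divide_inverse mult.commute)
  qed
  have "(\<lambda>n. norm (u n)) \<longlonglongrightarrow> 0"
  proof (rule contraction_tendsto_0)
    \<comment> \<open>As \<open>k n\<close> only tends to \<open>L + r\<close>, half of this rate is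
      used as an eventual lower bound.\<close>
    show "0 < (L + r) / 2" using pos by simp
    have "(\<lambda>n. v n - k n *\<^sub>R z) \<longlonglongrightarrow> w - (L + r) *\<^sub>R z"
      by (intro tendsto_intros v k)
    then show "(\<lambda>n. norm (v n - k n *\<^sub>R z)) \<longlonglongrightarrow> 0"
      using pos by (simp add: z_def tendsto_norm_zero_iff)
    \<comment> \<open>The lower bound supplies the contraction; the upper bound, with
      \<open>n > L + r + 1\<close>, keeps \<open>1 - k n / n\<close> nonnegative.\<close>
    have "eventually (\<lambda>n. k n > (L + r) / 2) sequentially"
      "eventually (\<lambda>n. k n < L + r + 1) sequentially"
      using order_tendstoD(1)[OF k, of "(L + r) / 2"] order_tendstoD(2)[OF k, of "L + r + 1"] pos by simp_all
    moreover have "eventually (\<lambda>n. real n > L + r + 1) sequentially" by real_asymp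
    ultimately show "eventually (\<lambda>n. norm (u (Suc n)) \<le>
        (1 - (L + r) / 2 / real n) * norm (u n) + norm (v n - k n *\<^sub>R z) / real n) sequentially"
      using eventually_gt_at_top[of 0]
    proof eventually_elim
      case (elim n)
      have a: "norm (1 - k n / real n) \<le> 1 - (L + r) / 2 / real n"
      proof -
        have "k n / real n \<le> 1" using elim pos by simp
        moreover have "(L + r) / 2 / real n \<le> k n / real n"
          using elim by (intro divide_right_mono) auto
        ultimately show ?thesis by simp
      qed
      have "norm (u (Suc n)) \<le> norm (1 - k n / real n) * norm (u n) + norm (v n - k n *\<^sub>R z) / real n"
        unfolding eq[OF elim(4)] by (rule norm_triangle_le) (simp add: divide_inverse mult.commute)
      also have "\<dots> \<le> (1 - (L + r) / 2 / real n) * norm (u n) + norm (v n - k n *\<^sub>R z) / real n"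
        by (intro add_right_mono mult_right_mono a) auto
      finally show ?case .
    qed
  qed auto
  then have "u \<longlonglongrightarrow> 0" by (simp add: tendsto_norm_zero_iff)
  then have "(\<lambda>n. u n + z) \<longlonglongrightarrow> 0 + z" by (intro tendsto_add tendsto_const)
  then show ?thesis by (simp add: u_def z_def)
qed

section \<open>Moments, weak convergence and uniform convergence\<close>

text \<open>A characteristic function differs from its Taylor polynomial of degree \<open>2 k\<close> by at most twice
  the absolute value of the last term, and for the normal law this bound tends to \<open>0\<close> as \<open>k\<close> grows.\<close>
lemma moments_imp_weak_conv_std_normal:
  fixes D :: "nat \<Rightarrow> real measure"
  assumes D: "\<And>n. real_distribution (D n)"
    and int: "\<And>n k. integrable (D n) (\<lambda>x. x ^ k)"
    and lim: "\<And>k. (\<lambda>n. LINT x|D n. x ^ k) \<longlonglongrightarrow> (LINT x|std_normal_distribution. x ^ k)"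
  shows "weak_conv_m D std_normal_distribution"
proof (rule levy_continuity[OF D real_dist_normal_dist])
  fix t :: real
  let ?N = "std_normal_distribution"
  define S where "S E k = (\<Sum>j\<le>2 * k. (\<i> * t) ^ j / fact j * (LINT x|E. x ^ j))" for E :: "real measure" and k :: nat
  define b where "b E k = 2 * \<bar>t\<bar> ^ (2 * k) / fact (2 * k) * (LINT x|E. x ^ (2 * k))" for E :: "real measure" and k
  \<comment> \<open>The even degree turns the absolute moment in the error bound into an ordinary
    moment.\<close>
  have approx: "cmod (char E t - S E k) \<le> b E k"
    if "real_distribution E" "\<And>k. integrable E (\<lambda>x. x ^ k)" for E k
    using real_distribution.char_approx1[OF that(1), where n = "2 * k" and t = t] that(2)
    by (simp add: S_def b_def power_even_abs)
  show "(\<lambda>n. char (D n) t) \<longlonglongrightarrow> char ?N t"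
  proof (rule tendstoI)
    fix \<epsilon> :: real assume \<epsilon>: "0 < \<epsilon>"
    \<comment> \<open>The normal moment \<open>fact (2 * k) / (2 ^ k * fact k)\<close> cancels the
      factorial in \<open>b\<close>.\<close>
    have "b ?N k = 2 * ((t\<^sup>2 / 2) ^ k / fact k)" for k
      unfolding b_def std_normal_distribution_even_moments by (simp add: power_divide power_mult)
    moreover have "(\<lambda>k. 2 * ((t\<^sup>2 / 2) ^ k / fact k)) \<longlonglongrightarrow> 0"
      using summable_LIMSEQ_zero[OF summable_exp[of "t\<^sup>2 / 2"]]
      by (intro tendsto_mult_right_zero) (simp add: field_simps)
    ultimately have "b ?N \<longlonglongrightarrow> 0" by presburger
    then have "eventually (\<lambda>k. b ?N k < \<epsilon> / 4) sequentially"
      using \<epsilon> by (intro order_tendstoD) auto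
    then obtain k where k: "b ?N k < \<epsilon> / 4" by (auto simp: eventually_sequentially)
    have "(\<lambda>n. S (D n) k) \<longlonglongrightarrow> S ?N k" "(\<lambda>n. b (D n) k) \<longlonglongrightarrow> b ?N k"
      unfolding S_def b_def by (intro tendsto_intros lim)+
    then have "eventually (\<lambda>n. dist (S (D n) k) (S ?N k) < \<epsilon> / 4) sequentially"
      "eventually (\<lambda>n. b (D n) k < \<epsilon> / 4) sequentially"
      using \<epsilon> tendstoD[where e = "\<epsilon> / 4"] order_tendstoD(2)[OF _ k] by simp_all
    then show "eventually (\<lambda>n. dist (char (D n) t) (char ?N t) < \<epsilon>) sequentially"
    proof eventually_elim
      case (elim n)
      have "cmod (char (D n) t - S (D n) k) \<le> b (D n) k" "cmod (char ?N t - S ?N k) \<le> b ?N k"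
        by (intro approx D int real_dist_normal_dist integrable_std_normal_distribution_moment)+
      then show ?case using elim k unfolding dist_norm by norm
    qed
  qed
qed

lemma std_normal_isCont_cdf: "isCont (cdf std_normal_distribution) x"
proof -
  interpret real_distribution std_normal_distribution by (rule real_dist_normal_dist)
  have "emeasure std_normal_distribution {x} = 0"
    by (subst emeasure_density) (auto simp: nn_integral_cmult_indicator nn_integral_indicator_singleton)
  then show ?thesis by (simp add: isCont_cdf measure_def)
qed

text \<open>Polya's theorem: by monotonicity it suffices to compare the distribution functions at the
  finitely many points where the limit takes the values \<open>i / (m + 1)\<close>.\<close>
lemma weak_conv_m_imp_uniform_cdf:
  fixes D :: "nat \<Rightarrow> real measure"
  assumes D: "\<And>n. real_distribution (D n)" and N: "real_distribution N"
    and conv: "weak_conv_m D N" and cont: "\<And>x. isCont (cdf N) x"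
  shows "(\<lambda>n. SUP x. \<bar>cdf (D n) x - cdf N x\<bar>) \<longlonglongrightarrow> 0"
proof (rule tendstoI)
  fix \<epsilon> :: real assume \<epsilon>: "0 < \<epsilon>"
  interpret N: real_distribution N by (rule N)
  define \<delta> where "\<delta> = \<epsilon> / 4"
  have \<delta>: "0 < \<delta>" using \<epsilon> by (simp add: \<delta>_def)
  have pt: "(\<lambda>n. cdf (D n) x) \<longlonglongrightarrow> cdf N x" for x
    using conv cont by (auto simp: weak_conv_m_def weak_conv_def)
  have level: "\<exists>y. cdf N y = c" if c: "0 < c" "c < 1" for c
  proof -
    have "eventually (\<lambda>x. cdf N x < c) at_bot" "eventually (\<lambda>x. cdf N x > c) at_top"
      using order_tendstoD[OF N.cdf_lim_at_bot] order_tendstoD[OF N.cdf_lim_at_top_prob] c by auto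
    then obtain a b where ab: "cdf N a < c" "cdf N b > c"
      by (auto simp: eventually_at_bot_linorder eventually_at_top_linorder)
    then have "a \<le> b" using N.cdf_nondecreasing[of b a] by linarith
    with ab cont show ?thesis using IVT[of "cdf N" a c b] by auto
  qed
  obtain m :: nat where m: "1 / real (Suc m) < \<delta>"
    using \<delta> reals_Archimedean by (auto simp: inverse_eq_divide)
  define I where "I = {1..m}"
  have "\<forall>i\<in>I. \<exists>y. cdf N y = real i / real (Suc m)"
    by (auto simp: I_def intro!: level)
  then obtain y where y: "\<And>i. i \<in> I \<Longrightarrow> cdf N (y i) = real i / real (Suc m)" by metis
  have "eventually (\<lambda>n. \<forall>i\<in>I. dist (cdf (D n) (y i)) (cdf N (y i)) < \<delta>) sequentially"
    using \<delta> by (intro eventually_ball_finite ballI tendstoD[OF pt]) (auto simp: I_def)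
  then show "eventually (\<lambda>n. dist (SUP x. \<bar>cdf (D n) x - cdf N x\<bar>) 0 < \<epsilon>) sequentially"
  proof eventually_elim
    case (elim n)
    interpret D: real_distribution "D n" by (rule D)
    have close: "\<bar>cdf (D n) x - cdf N x\<bar> \<le> 3 * \<delta>" for x
    proof -
      \<comment> \<open>\<open>c\<close> locates \<open>x\<close> between the levels: the first one
        strictly above it is \<open>\<lfloor>c\<rfloor> + 1\<close>, the last one strictly below it
        \<open>\<lceil>c\<rceil> - 1\<close>. When such an index falls outside \<open>I\<close>,
        \<open>cdf N x\<close> is within \<open>1 / (m + 1)\<close> of 1 or 0 respectively, and the
        trivial bounds on \<open>cdf (D n) x\<close> suffice.\<close>
      define c where "c = real (Suc m) * cdf N x"
      have c0: "0 \<le> c" by (simp add: c_def N.cdf_nonneg)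
      have Nx: "cdf N x = c / real (Suc m)" by (simp add: c_def)
      have "cdf (D n) x \<le> cdf N x + 3 * \<delta>"
      proof (cases "nat \<lfloor>c\<rfloor> + 1 \<in> I")
        case True
        let ?i = "nat \<lfloor>c\<rfloor> + 1"
        have i: "c < real ?i" "real ?i \<le> c + 1" using c0 by linarith+
        then have "cdf N x < cdf N (y ?i)" "cdf N (y ?i) \<le> cdf N x + 1 / real (Suc m)"
          unfolding y[OF True] Nx add_divide_distrib [symmetric]
          by (auto intro!: divide_strict_right_mono divide_right_mono)
        then have "x \<le> y ?i" using N.cdf_nondecreasing[of "y ?i" x] by linarith
        then have "cdf (D n) x \<le> cdf (D n) (y ?i)" by (rule D.cdf_nondecreasing)
        also have "\<dots> \<le> cdf N (y ?i) + \<delta>" using elim True by (force simp: dist_real_def)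
        finally show ?thesis using \<open>cdf N (y ?i) \<le> _\<close> m \<delta> by linarith
      next
        case False
        then have "real m \<le> c" using c0 by (simp add: I_def) linarith
        then have "1 \<le> cdf N x + 1 / real (Suc m)" by (simp add: Nx field_simps)
        then show ?thesis using D.cdf_bounded_prob[of x] m \<delta> by linarith
      qed
      moreover have "cdf (D n) x \<ge> cdf N x - 3 * \<delta>"
      proof (cases "nat (\<lceil>c\<rceil> - 1) \<in> I")
        case True
        let ?i = "nat (\<lceil>c\<rceil> - 1)"
        have "?i \<ge> 1" using True by (simp add: I_def)
        then have i: "real ?i < c" "c \<le> real ?i + 1" by linarith+
        then have "cdf N (y ?i) < cdf N x" "cdf N x \<le> cdf N (y ?i) + 1 / real (Suc m)"
          unfolding y[OF True] Nx add_divide_distrib [symmetric]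
          by (auto intro!: divide_strict_right_mono divide_right_mono)
        then have "y ?i \<le> x" using N.cdf_nondecreasing[of x "y ?i"] by linarith
        then have "cdf (D n) (y ?i) \<le> cdf (D n) x" by (rule D.cdf_nondecreasing)
        moreover have "cdf N (y ?i) - \<delta> \<le> cdf (D n) (y ?i)" using elim True by (force simp: dist_real_def)
        ultimately show ?thesis using \<open>cdf N x \<le> _\<close> m \<delta> by linarith
      next
        case False
        have "c \<le> real (Suc m) * 1" unfolding c_def using N.cdf_bounded_prob[of x] by (intro mult_left_mono) auto
        then have "\<lceil>c\<rceil> \<le> int (Suc m)" by (simp add: ceiling_le_iff)
        then have "c \<le> 1" using False c0 by (simp add: I_def) linarith
        then have "cdf N x \<le> 1 / real (Suc m)" by (simp add: Nx divide_right_mono)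
        then show ?thesis using D.cdf_nonneg[of x] m \<delta> by linarith
      qed
      ultimately show ?thesis by linarith
    qed
    have "(SUP x. \<bar>cdf (D n) x - cdf N x\<bar>) \<le> 3 * \<delta>"
      by (rule cSUP_least) (auto simp: close)
    moreover have "0 \<le> (SUP x. \<bar>cdf (D n) x - cdf N x\<bar>)"
      by (rule cSUP_upper2[of _ _ 0]) (auto intro!: bdd_aboveI2 close)
    ultimately show ?case using \<epsilon> by (simp add: \<delta>_def)
  qed
qed

text \<open>The law of \<open>X\<close> has a density with respect to counting measure, so integrals
  against it are series. This links expectations to values of power series at 1.\<close>

lemma nat_valued_expectation:
  fixes h :: "nat \<Rightarrow> real"
  assumes "prob_space M" and X: "X \<in> measurable M (count_space UNIV)"
    and s: "summable (\<lambda>k. \<bar>h k\<bar> * measure M {\<omega> \<in> space M. X \<omega> = k})"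
  shows "integrable M (\<lambda>\<omega>. h (X \<omega>))"
    and "(\<lambda>k. h k * measure M {\<omega> \<in> space M. X \<omega> = k}) sums (LINT \<omega>|M. h (X \<omega>))"
proof -
  interpret prob_space M by fact
  define p where "p k = measure M {\<omega> \<in> space M. X \<omega> = k}" for k
  have p0: "p k \<ge> 0" for k by (simp add: p_def)
  have D: "distr M (count_space UNIV) X = density (count_space UNIV) (\<lambda>k. ennreal (p k))"
  proof (rule measure_eqI_countable[where A=UNIV])
    fix k :: nat
    have "X -` {k} \<inter> space M = {\<omega> \<in> space M. X \<omega> = k}" by auto
    then show "emeasure (distr M (count_space UNIV) X) {k} = emeasure (density (count_space UNIV) (\<lambda>k. ennreal (p k))) {k}"
      by (simp add: emeasure_distr X emeasure_density p_def emeasure_eq_measure 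
          nn_integral_indicator_singleton)
  qed auto
  have "integrable (count_space UNIV) (\<lambda>k. p k * h k)"
    using s p0 by (simp add: integrable_count_space_nat_iff p_def abs_mult mult.commute)
  note i = this
  show "integrable M (\<lambda>\<omega>. h (X \<omega>))"
    using i p0 by (subst integrable_distr_eq[OF X, symmetric]) (auto simp: D integrable_density)
  have "(LINT \<omega>|M. h (X \<omega>)) = (LINT k|count_space UNIV. p k * h k)"
    using p0 by (subst integral_distr[OF X, symmetric]) (auto simp: D integral_density)
  then show "(\<lambda>k. h k * measure M {\<omega> \<in> space M. X \<omega> = k}) sums (LINT \<omega>|M. h (X \<omega>))"
    using sums_integral_count_space_nat[OF i] by (simp add: p_def mult.commute)
qed

section \<open>Power series in the exponential variable\<close>

text \<open>By compactness the domain of holomorphy contains an \<open>e\<close>-neighbourhood of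
  the closed disc, and a point outside the disc has distance \<open>norm z - 1\<close> to
  \<open>sgn z\<close>. The point 1 thereby becomes an interior point.\<close>

lemma analytic_on_unit_disc_imp_holomorphic_on_ball:
  fixes f :: "complex \<Rightarrow> complex"
  assumes "f analytic_on cball 0 1"
  obtains R where "1 < R" "f holomorphic_on ball 0 R"
proof -
  obtain T where T: "open T" "cball 0 1 \<subseteq> T" "f holomorphic_on T"
    using assms unfolding analytic_on_holomorphic by blast
  obtain e where e: "e > 0" "(\<Union>x\<in>cball 0 1. ball x e) \<subseteq> T"
    using compact_subset_open_imp_ball_epsilon_subset[OF compact_cball T(1,2)] by blast
  have "ball 0 (1 + e) \<subseteq> T"
  proof
    fix z :: complex assume z: "z \<in> ball 0 (1 + e)"
    show "z \<in> T"
    proof (cases "norm z \<le> 1")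
      case True
      then show ?thesis using T(2) by auto
    next
      case False
      then have "cmod z \<noteq> 0" by auto
      then have "norm (sgn z) = 1" by (auto simp: norm_sgn)
      have "sgn z - z = (1 - norm z) *\<^sub>R sgn z"
        using False \<open>cmod z \<noteq> 0\<close> by (simp add: sgn_div_norm algebra_simps)
      then have "dist (sgn z) z = norm z - 1"
        using False \<open>norm (sgn z) = 1\<close> by (simp add: dist_norm)
      with z \<open>norm (sgn z) = 1\<close> show ?thesis
        using e(2) by (intro subsetD[OF e(2)] UN_I[of "sgn z"]) auto
    qed
  qed
  with T(3) e(1) show ?thesis
    by (intro that[of "1 + e"]) (auto intro: holomorphic_on_subset)
qed

text \<open>For a probability generating function \<open>f\<close> this is the moment generating
  function centred at \<open>c\<close>.\<close>

definition exp_twist :: "complex \<Rightarrow> (complex \<Rightarrow> complex) \<Rightarrow> complex \<Rightarrow> complex" where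
  "exp_twist c f s = exp (- (c * s)) * f (exp s)"

text \<open>The operator \<open>v d/dv - c\<close> multiplies the coefficient of
  \<open>v ^ j\<close> by \<open>j - c\<close> and becomes \<open>d/ds\<close> under the
  twist.\<close>

definition euler_op :: "complex \<Rightarrow> (complex \<Rightarrow> complex) \<Rightarrow> complex \<Rightarrow> complex" where
  "euler_op c f v = v * deriv f v - c * f v"

lemma holomorphic_on_euler_op [holomorphic_intros]:
  "f holomorphic_on U \<Longrightarrow> open U \<Longrightarrow> euler_op c f holomorphic_on U"
  unfolding euler_op_def[abs_def] by (intro holomorphic_intros)

lemma exp_twist_has_field_derivative:
  assumes "f holomorphic_on U" "open U" "exp s \<in> U"
  shows "(exp_twist c f has_field_derivative exp_twist c (euler_op c f) s) (at s)"
proof -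
  have "(f has_field_derivative deriv f (exp s)) (at (exp s))"
    using assms by (rule holomorphic_derivI)
  then have "((\<lambda>s. f (exp s)) has_field_derivative deriv f (exp s) * exp s) (at s)"
    using DERIV_chain2 DERIV_exp by blast
  then show ?thesis
    unfolding exp_twist_def[abs_def] euler_op_def
    by (auto intro!: derivative_eq_intros simp: algebra_simps)
qed

text \<open>Each derivative passes through the twist as one application of \<open>euler_op\<close>.
  The identity for one derivative is needed on a neighbourhood of \<open>s\<close>, because it is
  differentiated again.\<close>

lemma higher_deriv_exp_twist:
  assumes "f holomorphic_on U" "open U" "exp s \<in> U"
  shows "(deriv ^^ k) (exp_twist c f) s = exp_twist c ((euler_op c ^^ k) f) s"
  using assms(1)
proof (induction k arbitrary: f)
  case (Suc k)
  have "open (exp -` U)"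
    using assms(2) by (intro open_vimage continuous_intros)
  then have "eventually (\<lambda>z. z \<in> exp -` U) (nhds s)"
    using assms(3) by (intro eventually_nhds_in_open) auto
  then have "eventually (\<lambda>z. deriv (exp_twist c f) z = exp_twist c (euler_op c f) z) (nhds s)"
    by eventually_elim
      (use Suc.prems assms(2) in \<open>auto intro!: DERIV_imp_deriv exp_twist_has_field_derivative\<close>)
  then have "(deriv ^^ k) (deriv (exp_twist c f)) s = (deriv ^^ k) (exp_twist c (euler_op c f)) s"
    by (rule higher_deriv_cong_ev) auto
  also have "\<dots> = exp_twist c ((euler_op c ^^ k) (euler_op c f)) s"
    using Suc.prems assms(2) by (intro Suc.IH holomorphic_intros)
  finally show ?case by (simp add: funpow_Suc_right del: funpow.simps)
qed auto

lemma exp_twist_has_fps_expansion: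
  assumes "f holomorphic_on U" "open U" "1 \<in> U"
  shows "exp_twist c f has_fps_expansion fps_expansion (exp_twist c f) 0"
proof (rule has_fps_expansion_fps_expansion)
  show "open (exp -` U)"
    using assms(2) by (intro open_vimage continuous_intros)
  show "exp_twist c f holomorphic_on exp -` U"
    unfolding exp_twist_def[abs_def]
    by (intro holomorphic_intros holomorphic_on_compose_gen[OF _ assms(1), unfolded o_def]) auto
qed (use assms in auto)

lemma exp_twist_fps_nth:
  assumes "f holomorphic_on U" "open U" "1 \<in> U"
  shows "fps_nth (fps_expansion (exp_twist c f) 0) k = (euler_op c ^^ k) f 1 / fact k"
  using higher_deriv_exp_twist[OF assms(1,2), of 0 k c] assms(3)
  by (simp add: fps_expansion_def) (simp add: exp_twist_def)

lemma euler_op_twice: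
  assumes "f holomorphic_on U" "open U" "1 \<in> U"
  shows "(euler_op c ^^ 2) f 1 = (deriv ^^ 2) f 1 + (1 - 2 * c) * deriv f 1 + c\<^sup>2 * f 1"
proof -
  have d: "(f has_field_derivative deriv f 1) (at 1)"
    using assms by (intro holomorphic_derivI)
  have dd: "(deriv f has_field_derivative deriv (deriv f) 1) (at 1)"
    using assms by (intro holomorphic_derivI[OF holomorphic_deriv]) auto
  have "(euler_op c f has_field_derivative deriv f 1 + deriv (deriv f) 1 - c * deriv f 1) (at 1)"
    unfolding euler_op_def[abs_def] by (auto intro!: derivative_eq_intros d dd)
  from DERIV_imp_deriv[OF this] show ?thesis
    by (simp add: eval_nat_numeral euler_op_def[of c "euler_op c f"]) (simp add: euler_op_def algebra_simps)
qed

text \<open>Every application of \<open>euler_op\<close> multiplies the coefficient of index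
  \<open>j\<close> by \<open>j - c\<close>, and \<open>1 < R\<close> gives convergence at 1. For a
  generating function the sums are its centred moments.\<close>

lemma power_sums_euler_op:
  assumes "f holomorphic_on ball 0 R" "1 < R"
  shows "(\<lambda>j. (of_nat j - c) ^ k * fps_nth (fps_expansion f 0) j) sums (euler_op c ^^ k) f 1"
  using assms(1)
proof (induction k arbitrary: f)
  case 0
  have "f has_fps_expansion fps_expansion f 0"
    using 0 assms(2) by (intro has_fps_expansion_fps_expansion[of "ball 0 R"]) auto
  from has_fps_expansion_imp_sums_complex[OF this, of R 1] show ?case
    using 0 assms(2) by simp
next
  case (Suc k)
  have "f has_fps_expansion fps_expansion f 0"
    using Suc.prems assms(2) by (intro has_fps_expansion_fps_expansion[of "ball 0 R"]) auto
  then have "euler_op c f has_fps_expansion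
      fps_X * fps_deriv (fps_expansion f 0) - fps_const c * fps_expansion f 0"
    unfolding euler_op_def[abs_def] by (intro fps_expansion_intros)
  from fps_expansion_eqI[OF this]
  have "fps_nth (fps_expansion (euler_op c f) 0) j = (of_nat j - c) * fps_nth (fps_expansion f 0) j" for j
    unfolding \<open>fps_expansion (euler_op c f) 0 = _\<close> by (cases j) (auto simp: algebra_simps)
  with Suc.IH[of "euler_op c f"] Suc.prems show ?case
    by (simp add: funpow_Suc_right holomorphic_intros mult_ac del: funpow.simps)
qed

section \<open>The recurrence for the centred moment generating functions\<close>

locale eulerian_recurrence =
  fixes \<alpha> \<beta> \<gamma> P\<^sub>0 :: "complex \<Rightarrow> complex" and R :: real
  assumes R: "1 < R"
    and hol: "\<alpha> holomorphic_on ball 0 R" "\<beta> holomorphic_on ball 0 R"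
      "\<gamma> holomorphic_on ball 0 R" "P\<^sub>0 holomorphic_on ball 0 R"
    and nonzero: "\<And>n. eulerian_seq \<alpha> \<beta> \<gamma> P\<^sub>0 n 1 \<noteq> 0"
begin

abbreviation P :: "nat \<Rightarrow> complex \<Rightarrow> complex" where
  "P \<equiv> eulerian_seq \<alpha> \<beta> \<gamma> P\<^sub>0"

text \<open>The derivative term vanishes at \<open>v = 1\<close>, so this is the ratio of
  consecutive values \<open>P n 1\<close>.\<close>

definition N :: "nat \<Rightarrow> complex" where
  "N n = \<alpha> 1 * of_nat (Suc n) + \<gamma> 1"

lemma P_holomorphic: "P n holomorphic_on ball 0 R"
  by (induction n) (auto intro!: holomorphic_intros hol)

lemma P_Suc_1: "P (Suc n) 1 = N n * P n 1"
  by (simp add: N_def)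

lemma N_nonzero: "N n \<noteq> 0"
  using nonzero[of "Suc n"] P_Suc_1[of n] by auto

text \<open>\<open>P n (exp s) / P n 1\<close> is the moment generating function of \<open>X\<^sub>n\<close>; it is centred at \<open>m n\<close>, with
  \<open>m\<close> complex because \<open>\<mu>\<close> is not known to be real beforehand.\<close>
definition \<Phi> :: "complex \<Rightarrow> nat \<Rightarrow> complex \<Rightarrow> complex" where
  "\<Phi> m n s = exp_twist (m * of_nat n) (P n) s / P n 1"

text \<open>The coefficient of index \<open>k\<close> is the \<open>k\<close>-th moment about
  \<open>m * n\<close> divided by \<open>fact k\<close>.\<close>

definition F :: "complex \<Rightarrow> nat \<Rightarrow> complex fps" where
  "F m n = fps_expansion (\<Phi> m n) 0"

text \<open>Passing from \<open>n\<close> to \<open>n + 1\<close> moves the centre by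
  \<open>m\<close>, which leaves a factor \<open>exp (- (m * s))\<close> on the coefficient
  functions.\<close>

definition A :: "complex \<Rightarrow> complex fps" where
  "A m = fps_expansion (exp_twist m \<alpha>) 0"

text \<open>The shift to \<open>m + 1\<close> comes from \<open>(1 - v) d/dv = exp (-s) (1 - exp s) d/ds\<close>.\<close>
definition B :: "complex \<Rightarrow> complex fps" where
  "B m = fps_expansion (exp_twist (m + 1) (\<lambda>v. \<beta> v * (1 - v))) 0"

definition C :: "complex \<Rightarrow> complex fps" where
  "C m = fps_expansion (exp_twist m \<gamma>) 0"

lemma \<Phi>_has_fps_expansion: "\<Phi> m n has_fps_expansion F m n"
proof -
  define G where "G = fps_expansion (exp_twist (m * of_nat n) (P n)) 0"
  have "exp_twist (m * of_nat n) (P n) has_fps_expansion G"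
    unfolding G_def using R by (intro exp_twist_has_fps_expansion[OF P_holomorphic]) auto
  then have "\<Phi> m n has_fps_expansion G * fps_const (inverse (P n 1))"
    unfolding \<Phi>_def[abs_def] divide_inverse by (intro fps_expansion_intros)
  then show ?thesis using fps_expansion_eqI unfolding F_def by metis
qed

lemma F_nth: "fps_nth (F m n) k = (euler_op (m * of_nat n) ^^ k) (P n) 1 / P n 1 / fact k"
proof -
  have "exp_twist (m * of_nat n) (P n) has_fps_expansion fps_expansion (exp_twist (m * of_nat n) (P n)) 0"
    using R by (intro exp_twist_has_fps_expansion[OF P_holomorphic]) auto
  then have "\<Phi> m n has_fps_expansion
      fps_expansion (exp_twist (m * of_nat n) (P n)) 0 * fps_const (inverse (P n 1))"
    unfolding \<Phi>_def[abs_def] divide_inverse by (intro fps_expansion_intros)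
  from fps_expansion_eqI[OF this] show ?thesis
    using R by (simp add: F_def exp_twist_fps_nth[OF P_holomorphic] divide_inverse mult_ac)
qed

text \<open>Put \<open>v = exp s\<close> in the defining recurrence and divide by
  \<open>P n 1\<close>. Differentiating the centring factor of \<open>\<Phi> m n\<close> costs
  \<open>- m * n * \<Phi> m n\<close>; compensating for it produces the term
  \<open>m * n * B m\<close>.\<close>

lemma F_recurrence:
  "fps_const (N n) * F m (Suc n) =
    (fps_const (of_nat (Suc n)) * A m + C m + fps_const (m * of_nat n) * B m) * F m n
    + B m * fps_deriv (F m n)"
proof (rule fps_expansion_unique_complex)
  have one: "(1::complex) \<in> ball 0 R" using R by simp
  let ?a = "exp_twist m \<alpha>" and ?c = "exp_twist m \<gamma>" and ?b = "exp_twist (m + 1) (\<lambda>v. \<beta> v * (1 - v))"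
  have abc: "?a has_fps_expansion A m" "?b has_fps_expansion B m" "?c has_fps_expansion C m"
    unfolding A_def B_def C_def
    by (rule exp_twist_has_fps_expansion[where U = "ball 0 R"]; use one in \<open>auto intro!: holomorphic_intros hol\<close>)+
  show "(\<lambda>s. (of_nat (Suc n) * ?a s + ?c s + m * of_nat n * ?b s) * \<Phi> m n s + ?b s * deriv (\<Phi> m n) s)
      has_fps_expansion (fps_const (of_nat (Suc n)) * A m + C m + fps_const (m * of_nat n) * B m) * F m n
      + B m * fps_deriv (F m n)"
    by (intro fps_expansion_intros abc \<Phi>_has_fps_expansion)
  have "(\<lambda>s. N n * \<Phi> m (Suc n) s) has_fps_expansion fps_const (N n) * F m (Suc n)"
    by (intro fps_expansion_intros \<Phi>_has_fps_expansion)
  also have "?this \<longleftrightarrow> (\<lambda>s. (of_nat (Suc n) * ?a s + ?c s + m * of_nat n * ?b s) * \<Phi> m n s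
      + ?b s * deriv (\<Phi> m n) s) has_fps_expansion fps_const (N n) * F m (Suc n)"
  proof (rule has_fps_expansion_cong)
    \<comment> \<open>The identity is only needed near 0, where \<open>exp s\<close> stays in the
      disc.\<close>
    have "open (exp -` ball 0 R :: complex set)"
      by (intro open_vimage continuous_intros) auto
    then have "eventually (\<lambda>s::complex. s \<in> exp -` ball 0 R) (nhds 0)"
      using one by (intro eventually_nhds_in_open) auto
    then show "eventually (\<lambda>s. N n * \<Phi> m (Suc n) s =
        (of_nat (Suc n) * ?a s + ?c s + m * of_nat n * ?b s) * \<Phi> m n s + ?b s * deriv (\<Phi> m n) s) (nhds 0)"
    proof eventually_elim
      case (elim s)
      let ?M = "m * of_nat n"
      have "(exp_twist ?M (P n) has_field_derivative exp_twist ?M (euler_op ?M (P n)) s) (at s)"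
        using elim by (intro exp_twist_has_field_derivative[OF P_holomorphic]) auto
      then have d: "deriv (\<Phi> m n) s = exp_twist ?M (euler_op ?M (P n)) s / P n 1"
        unfolding \<Phi>_def[abs_def] by (intro DERIV_imp_deriv DERIV_cdivide)
      have e: "exp (- (m * of_nat (Suc n) * s)) = exp (- (m * s)) * exp (- (?M * s))"
        "exp (- ((m + 1) * s)) = exp (- (m * s)) / exp s"
        by (simp_all add: exp_add exp_diff exp_minus field_simps)
      have "N n * \<Phi> m (Suc n) s = exp_twist (m * of_nat (Suc n)) (P (Suc n)) s / P n 1"
        unfolding \<Phi>_def P_Suc_1 using N_nonzero by simp
      also have "\<dots> = (of_nat (Suc n) * ?a s + ?c s + m * of_nat n * ?b s) * \<Phi> m n s + ?b s * deriv (\<Phi> m n) s"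
        unfolding d unfolding \<Phi>_def exp_twist_def e euler_op_def eulerian_seq.simps
        using nonzero[of n] by (simp add: divide_simps) (simp add: algebra_simps)
      finally show ?case .
    qed
  qed auto
  finally show "(\<lambda>s. (of_nat (Suc n) * ?a s + ?c s + m * of_nat n * ?b s) * \<Phi> m n s
      + ?b s * deriv (\<Phi> m n) s) has_fps_expansion fps_const (N n) * F m (Suc n)" .
qed

lemma A_nth:
  "fps_nth (A m) 0 = \<alpha> 1" "fps_nth (A m) 1 = deriv \<alpha> 1 - m * \<alpha> 1"
  "fps_nth (A m) 2 = ((deriv ^^ 2) \<alpha> 1 + (1 - 2 * m) * deriv \<alpha> 1 + m\<^sup>2 * \<alpha> 1) / 2"
proof -
  have one: "(1::complex) \<in> ball 0 R" using R by simp
  note nth = exp_twist_fps_nth[OF hol(1) open_ball one]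
  show "fps_nth (A m) 0 = \<alpha> 1" "fps_nth (A m) 1 = deriv \<alpha> 1 - m * \<alpha> 1"
    by (simp_all add: A_def nth euler_op_def)
  show "fps_nth (A m) 2 = ((deriv ^^ 2) \<alpha> 1 + (1 - 2 * m) * deriv \<alpha> 1 + m\<^sup>2 * \<alpha> 1) / 2"
    unfolding A_def nth euler_op_twice[OF hol(1) open_ball one] by simp
qed

lemma C_nth_0: "fps_nth (C m) 0 = \<gamma> 1"
  using exp_twist_fps_nth[OF hol(3) open_ball, of m 0] R by (simp add: C_def)

text \<open>The factor \<open>1 - v\<close> vanishes at 1, so \<open>B m\<close> has no constant
  coefficient; hence the derivative of \<open>F m n\<close> brings no index above \<open>k\<close>
  into the recurrence for index \<open>k\<close>.\<close>

lemma B_nth: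
  "fps_nth (B m) 0 = 0" "fps_nth (B m) 1 = - \<beta> 1"
  "fps_nth (B m) 2 = ((2 * m + 1) * \<beta> 1 - 2 * deriv \<beta> 1) / 2"
proof -
  have one: "(1::complex) \<in> ball 0 R" using R by simp
  let ?h = "\<lambda>v. \<beta> v * (1 - v)"
  have h: "?h holomorphic_on ball 0 R" by (intro holomorphic_intros hol)
  note nth = exp_twist_fps_nth[OF h open_ball one]
  have l: "(\<lambda>v::complex. 1 - v) holomorphic_on ball 0 R" by (intro holomorphic_intros)
  have [simp]: "deriv (\<lambda>v::complex. 1 - v) = (\<lambda>v. -1)"
    by (intro ext DERIV_imp_deriv) (auto intro!: derivative_eq_intros)
  note hd = higher_deriv_mult[OF hol(2) l open_ball one]
  have d1: "deriv ?h 1 = - \<beta> 1" using hd[of 1] by simp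
  have d2: "(deriv ^^ 2) ?h 1 = - 2 * deriv \<beta> 1"
    unfolding hd by (simp add: numeral_2_eq_2)
  show "fps_nth (B m) 0 = 0" "fps_nth (B m) 1 = - \<beta> 1"
    by (simp_all add: B_def nth euler_op_def d1)
  show "fps_nth (B m) 2 = ((2 * m + 1) * \<beta> 1 - 2 * deriv \<beta> 1) / 2"
    unfolding B_def nth euler_op_twice[OF h open_ball one] d1 d2
    by (simp add: algebra_simps)
qed

lemma F_nth_0: "fps_nth (F m n) 0 = 1"
  using nonzero by (simp add: F_nth)

text \<open>Compare coefficients in \<open>F_recurrence\<close>. The term \<open>T 0 = 1\<close>
  keeps the old coefficient and the linear coefficient of \<open>B m\<close> damps it. The rest
  involves indices below \<open>k\<close> only: for \<open>i \<ge> 2\<close>,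
  \<open>Suc (k - i)\<close> is at most \<open>k - 1\<close>.\<close>

lemma F_nth_recurrence:
  fixes k n :: nat and m :: complex
  defines "T \<equiv> \<lambda>i. (of_nat (Suc n) * fps_nth (A m) i + fps_nth (C m) i + m * of_nat n * fps_nth (B m) i) / N n"
  shows "fps_nth (F m (Suc n)) k =
    (1 - of_nat k * \<beta> 1 / N n) * fps_nth (F m n) k
    + ((\<Sum>i=1..k. T i * fps_nth (F m n) (k - i))
      + (\<Sum>i=2..k. fps_nth (B m) i / N n * (of_nat (Suc (k - i)) * fps_nth (F m n) (Suc (k - i)))))"
proof -
  let ?S = "\<Sum>i=2..k. fps_nth (B m) i * (of_nat (Suc (k - i)) * fps_nth (F m n) (Suc (k - i)))"
  have s2: "(\<Sum>i=0..k. fps_nth (B m) i * (of_nat (Suc (k - i)) * fps_nth (F m n) (Suc (k - i)))) = 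
      - \<beta> 1 * (of_nat k * fps_nth (F m n) k) + ?S"
  proof (cases k)
    case (Suc j)
    then show ?thesis
      by (simp add: sum.atLeast_Suc_atMost numeral_2_eq_2 B_nth B_nth(2)[unfolded One_nat_def] del: of_nat_Suc)
  qed (simp add: B_nth)
  have "N n * fps_nth (F m (Suc n)) k = fps_nth (fps_const (N n) * F m (Suc n)) k" by simp
  also have "\<dots> = (\<Sum>i=0..k. N n * T i * fps_nth (F m n) (k - i))
      + (\<Sum>i=0..k. fps_nth (B m) i * (of_nat (Suc (k - i)) * fps_nth (F m n) (Suc (k - i))))"
  proof -
    have "fps_nth (fps_const (of_nat (Suc n)) * A m + C m + fps_const (m * of_nat n) * B m) i = N n * T i" for i
      using N_nonzero[of n] by (simp add: T_def)
    then show ?thesis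
      unfolding F_recurrence fps_add_nth[of "_ * F m n"] fps_mult_nth[of _ "F m n"]
        fps_mult_nth[of _ "fps_deriv (F m n)"] by (simp del: of_nat_Suc)
  qed
  also have "(\<Sum>i=0..k. N n * T i * fps_nth (F m n) (k - i)) = 
     N n * fps_nth (F m n) k + (\<Sum>i=1..k. N n * T i * fps_nth (F m n) (k - i))"
  proof -
    have "N n * T 0 = N n" using N_nonzero[of n]
      by (simp add: T_def A_nth B_nth C_nth_0) (simp add: N_def mult.commute)
    then show ?thesis by (simp add: sum.atLeast_Suc_atMost)
  qed
  finally show ?thesis
    using N_nonzero[of n] unfolding s2
    by (simp add: field_simps sum_distrib_left sum_divide_distrib del: of_nat_Suc)
qed

end

text \<open>The Taylor coefficients of \<open>exp (S s\<^sup>2 / 2)\<close>.\<close>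
fun gaussian_coeff :: "complex \<Rightarrow> nat \<Rightarrow> complex" where
  "gaussian_coeff S 0 = 1"
| "gaussian_coeff S (Suc 0) = 0"
| "gaussian_coeff S (Suc (Suc k)) = S * gaussian_coeff S k / of_nat (Suc (Suc k))"

lemma gaussian_coeff_even: "gaussian_coeff S (2 * j) = (S / 2) ^ j / fact j"
proof (induction j)
  case (Suc j)
  have "gaussian_coeff S (2 * Suc j) = S * gaussian_coeff S (2 * j) / of_nat (2 * Suc j)"
    by simp
  then show ?case unfolding Suc.IH by (simp add: field_simps)
qed auto

lemma gaussian_coeff_odd: "gaussian_coeff S (Suc (2 * j)) = 0"
  by (induction j) auto

text \<open>Both sides are the \<open>k\<close>-th moment of the centred normal law with variance
  \<open>s\<^sup>2\<close>.\<close>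

lemma gaussian_coeff_eq_moment:
  "fact k * gaussian_coeff (of_real (s\<^sup>2)) k = of_real (s ^ k * (LINT x|std_normal_distribution. x ^ k))"
proof (cases "even k")
  case True
  then obtain j where "k = 2 * j" by blast
  then show ?thesis
    unfolding \<open>k = 2 * j\<close> gaussian_coeff_even std_normal_distribution_even_moments
    by (simp add: power_mult power_divide)
next
  case False
  then obtain j where "k = Suc (2 * j)" by (metis oddE Suc_eq_plus1)
  then show ?thesis
    using integral_std_normal_distribution_moment_odd[OF False] by (simp add: gaussian_coeff_odd)
qed

section \<open>Scaling limits of the centred Taylor coefficients\<close>

context eulerian_recurrence
begin

text \<open>After scaling, only the coefficient of index \<open>k - 2\<close>, entering through
  \<open>T n 2\<close>, survives. With \<open>L = k * b / a\<close> and \<open>r = k / 2\<close> the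
  limit is \<open>\<tau> * h (k - 2) / (L + k / 2) = S * h (k - 2) / k\<close>, which is the
  recursion of \<open>gaussian_coeff\<close>.\<close>

lemma F_nth_limit:
  fixes a b g :: real and m S :: complex
  assumes real: "\<alpha> 1 = of_real a" "\<beta> 1 = of_real b" "\<gamma> 1 = of_real g"
    and pos: "0 < a" "0 < a + 2 * b"
    and m: "m * (\<alpha> 1 + \<beta> 1) = deriv \<alpha> 1"
    and S: "S * (\<alpha> 1 + 2 * \<beta> 1) =
      m * (\<alpha> 1 + 2 * \<beta> 1) + ((deriv ^^ 2) \<alpha> 1 - 2 * m * deriv \<beta> 1 - \<alpha> 1 * m\<^sup>2)"
  shows "(\<lambda>n. fps_nth (F m n) k /\<^sub>R real n powr (real k / 2)) \<longlonglongrightarrow> gaussian_coeff S k"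
proof (induction k rule: less_induct)
  case (less k)
  define h where "h = gaussian_coeff S"
  define M where "M n = a * real (Suc n) + g" for n
  have N_eq: "N n = of_real (M n)" for n by (simp add: N_def M_def real)
  have M0: "M n \<noteq> 0" for n using N_nonzero[of n] by (simp add: N_eq)
  have IH: "(\<lambda>n. fps_nth (F m n) j /\<^sub>R real n powr (real j / 2)) \<longlonglongrightarrow> h j" if "j < k" for j
    using less[OF that] by (simp add: h_def)
  have ev: "eventually (\<lambda>n::nat. n > 0) sequentially" by (rule eventually_gt_at_top)
  show ?case
  proof (cases "k = 0")
    case True
    \<comment> \<open>The index \<open>n = 0\<close> is left out because
      \<open>0 powr 0 = 0\<close>.\<close>
    have "eventually (\<lambda>n. 1 = fps_nth (F m n) k /\<^sub>R real n powr (real k / 2)) sequentially"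
      using ev by eventually_elim (simp add: True F_nth_0)
    then show ?thesis using True tendsto_const tendsto_cong by (fastforce intro: Lim_transform_eventually)
  next
    case k: False
    define T where "T n i = (of_nat (Suc n) * fps_nth (A m) i + fps_nth (C m) i
        + m * of_nat n * fps_nth (B m) i) / N n" for n i
    define \<tau> where "\<tau> = (fps_nth (A m) 2 + m * fps_nth (B m) 2) / of_real a"
    define y1 where "y1 n = (\<Sum>i=1..k. T n i * fps_nth (F m n) (k - i))" for n
    define y2 where "y2 n = (\<Sum>i=2..k. fps_nth (B m) i / N n *
        (of_nat (Suc (k - i)) * fps_nth (F m n) (Suc (k - i))))" for n
    have "\<tau> = S * (of_real a + 2 * of_real b) / (2 * of_real a)"
    proof -
      have "2 * (fps_nth (A m) 2 + m * fps_nth (B m) 2) = S * (\<alpha> 1 + 2 * \<beta> 1)"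
        unfolding S A_nth B_nth m[symmetric] by (simp add: field_simps power2_eq_square)
      then show ?thesis using pos by (simp add: \<tau>_def real field_simps)
    qed
    note \<tau>_eq = this
    have Tlim: "(\<lambda>n. T n i) \<longlonglongrightarrow> (fps_nth (A m) i + m * fps_nth (B m) i) / of_real a" for i
    proof -
      have "(\<lambda>n. real (Suc n) / M n) \<longlonglongrightarrow> inverse a" "(\<lambda>n. 1 / M n) \<longlonglongrightarrow> 0" "(\<lambda>n. real n / M n) \<longlonglongrightarrow> inverse a"
        unfolding M_def using pos by real_asymp+
      then have "(\<lambda>n. of_real (real (Suc n) / M n) * fps_nth (A m) i + of_real (1 / M n) * fps_nth (C m) i
          + m * of_real (real n / M n) * fps_nth (B m) i) \<longlonglongrightarrow>
          of_real (inverse a) * fps_nth (A m) i + of_real 0 * fps_nth (C m) i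
          + m * of_real (inverse a) * fps_nth (B m) i"
        by (intro tendsto_intros)
      then show ?thesis
        by (simp add: T_def N_eq add_divide_distrib divide_inverse distrib_left distrib_right mult_ac del: of_nat_Suc)
    qed
    \<comment> \<open>The choice of \<open>m\<close> cancels the part of the numerator proportional
      to \<open>n\<close>, so \<open>T n 1\<close> has order \<open>1 / n\<close>.\<close>
    have T1: "T n 1 = of_real (1 / M n) * (fps_nth (A m) 1 + fps_nth (C m) 1)" for n
    proof -
      have "fps_nth (A m) 1 + m * fps_nth (B m) 1 = 0"
        unfolding A_nth B_nth m[symmetric] by (simp add: algebra_simps)
      then have "of_nat n * (fps_nth (A m) 1 + m * fps_nth (B m) 1) = 0" by simp
      then have "of_nat (Suc n) * fps_nth (A m) 1 + fps_nth (C m) 1 + m * of_nat n * fps_nth (B m) 1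
          = fps_nth (A m) 1 + fps_nth (C m) 1"
        by (simp add: algebra_simps)
      then show ?thesis unfolding T_def N_eq by simp
    qed
    \<comment> \<open>\<open>1 - i / 2\<close> is what remains of the exponent
      \<open>(k - i) / 2\<close> in the induction hypothesis after division by
      \<open>n powr (k / 2 - 1)\<close>.\<close>
    have T_scaled: "(\<lambda>n. real n powr (1 - real i / 2) *\<^sub>R T n i) \<longlonglongrightarrow> (if i = 2 then \<tau> else 0)" if "i \<ge> 1" for i
    proof -
      consider "i = 1" | "i = 2" | "i > 2" using \<open>i \<ge> 1\<close> by linarith
      then show ?thesis
      proof cases
        case 1
        have "(\<lambda>n. real n powr (1 / 2) / M n) \<longlonglongrightarrow> 0" unfolding M_def using pos by real_asymp
        from tendsto_scaleR[OF this tendsto_const[of "fps_nth (A m) 1 + fps_nth (C m) 1"]]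
        show ?thesis unfolding 1 T1 by (simp add: scaleR_conv_of_real)
      next
        case 2
        have "(\<lambda>n. T n i) \<longlonglongrightarrow> \<tau>" unfolding 2 \<tau>_def by (rule Tlim)
        moreover have "eventually (\<lambda>n. T n i = real n powr (1 - real i / 2) *\<^sub>R T n i) sequentially"
          using ev by eventually_elim (simp add: 2)
        ultimately show ?thesis using 2 by (auto intro: Lim_transform_eventually)
      next
        case 3
        have "(\<lambda>n. real n powr (1 - real i / 2)) \<longlonglongrightarrow> 0"
          using 3 by (intro tendsto_neg_powr filterlim_real_sequentially) auto
        from tendsto_scaleR[OF this Tlim[of i]] show ?thesis using 3 by simp
      qed
    qed
    have scale: "(c *\<^sub>R x) * (z /\<^sub>R d) = (c / d) *\<^sub>R (x * z)" for c d :: real and x z :: complex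
      by (simp add: divide_inverse mult.commute)
    have scale': "x * u * of_real (c / v) * (z /\<^sub>R d) = (c / d) *\<^sub>R (x / of_real v * (u * z))"
      for c d v :: real and x u z :: complex
      unfolding scaleR_conv_of_real of_real_divide of_real_inverse by (simp only: divide_inverse mult_ac)
    have "(\<lambda>n. \<Sum>i=1..k. (real n powr (1 - real i / 2) *\<^sub>R T n i) *
        (fps_nth (F m n) (k - i) /\<^sub>R real n powr (real (k - i) / 2)))
        \<longlonglongrightarrow> (\<Sum>i=1..k. (if i = 2 then \<tau> else 0) * h (k - i))"
      by (intro tendsto_sum tendsto_mult T_scaled IH) auto
    moreover have "eventually (\<lambda>n. (\<Sum>i=1..k. (real n powr (1 - real i / 2) *\<^sub>R T n i) *
        (fps_nth (F m n) (k - i) /\<^sub>R real n powr (real (k - i) / 2)))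
        = y1 n /\<^sub>R real n powr (real k / 2 - 1)) sequentially"
      using ev
    proof eventually_elim
      case (elim n)
      have "real n powr (1 - real i / 2) / real n powr (real (k - i) / 2) = 1 / real n powr (real k / 2 - 1)"
        if "i \<in> {1..k}" for i
        using elim that by (simp add: powr_diff [symmetric] powr_minus_divide [symmetric] of_nat_diff diff_divide_distrib)
      then show ?case
        unfolding y1_def scaleR_sum_right
        by (intro sum.cong refl) (simp add: scale inverse_eq_divide)
    qed
    ultimately have y1: "(\<lambda>n. y1 n /\<^sub>R real n powr (real k / 2 - 1)) \<longlonglongrightarrow>
        (\<Sum>i=1..k. (if i = 2 then \<tau> else 0) * h (k - i))"
      by (rule Lim_transform_eventually)
    \<comment> \<open>Here the remaining exponent \<open>(3 - i) / 2\<close> is at most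
      \<open>1 / 2\<close>, so division by \<open>M n\<close>, which has order \<open>n\<close>,
      makes every term vanish.\<close>
    have "(\<lambda>n. \<Sum>i=2..k. fps_nth (B m) i * of_nat (Suc (k - i)) * of_real (real n powr ((3 - real i) / 2) / M n) *
        (fps_nth (F m n) (Suc (k - i)) /\<^sub>R real n powr (real (Suc (k - i)) / 2)))
        \<longlonglongrightarrow> (\<Sum>i=2..k. fps_nth (B m) i * of_nat (Suc (k - i)) * of_real 0 * h (Suc (k - i)))"
    proof (intro tendsto_sum tendsto_mult tendsto_const tendsto_of_real)
      fix i assume i: "i \<in> {2..k}"
      then show "(\<lambda>n. fps_nth (F m n) (Suc (k - i)) /\<^sub>R real n powr (real (Suc (k - i)) / 2)) \<longlonglongrightarrow> h (Suc (k - i))"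
        by (intro IH) auto
      have "(\<lambda>n. real n powr ((1 - real i) / 2)) \<longlonglongrightarrow> 0"
        using i by (intro tendsto_neg_powr filterlim_real_sequentially) auto
      moreover have "(\<lambda>n. real n / M n) \<longlonglongrightarrow> inverse a" unfolding M_def using pos by real_asymp
      ultimately have "(\<lambda>n. real n powr ((1 - real i) / 2) * (real n / M n)) \<longlonglongrightarrow> 0 * inverse a"
        by (rule tendsto_mult)
      moreover have "eventually (\<lambda>n. real n powr ((1 - real i) / 2) * (real n / M n) =
          real n powr ((3 - real i) / 2) / M n) sequentially"
        using ev
      proof eventually_elim
        case (elim n)
        have "(3 - real i) / 2 = (1 - real i) / 2 + 1" by (simp add: field_simps)
        then have "real n powr ((3 - real i) / 2) = real n powr ((1 - real i) / 2) * real n"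
          using elim by (simp only: powr_add) simp
        then show ?case by simp
      qed
      ultimately have "(\<lambda>n. real n powr ((3 - real i) / 2) / M n) \<longlonglongrightarrow> 0 * inverse a"
        by (rule Lim_transform_eventually)
      then show "(\<lambda>n. real n powr ((3 - real i) / 2) / M n) \<longlonglongrightarrow> 0" by simp
    qed
    moreover have "eventually (\<lambda>n. (\<Sum>i=2..k. fps_nth (B m) i * of_nat (Suc (k - i)) * of_real (real n powr ((3 - real i) / 2) / M n) *
        (fps_nth (F m n) (Suc (k - i)) /\<^sub>R real n powr (real (Suc (k - i)) / 2)))
        = y2 n /\<^sub>R real n powr (real k / 2 - 1)) sequentially"
      using ev
    proof eventually_elim
      case (elim n)
      have pw: "real n powr ((3 - real i) / 2) / real n powr (real (Suc (k - i)) / 2) = 1 / real n powr (real k / 2 - 1)"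
        if "i \<in> {2..k}" for i
        using elim that
        by (simp add: powr_diff [symmetric] powr_minus_divide [symmetric] of_nat_diff diff_divide_distrib add_divide_distrib)
      then show ?case
        unfolding y2_def scaleR_sum_right N_eq
        by (intro sum.cong refl, subst scale') (simp only: inverse_eq_divide pw)
    qed
    ultimately have y2: "(\<lambda>n. y2 n /\<^sub>R real n powr (real k / 2 - 1)) \<longlonglongrightarrow>
        (\<Sum>i=2..k. fps_nth (B m) i * of_nat (Suc (k - i)) * of_real 0 * h (Suc (k - i)))"
      by (rule Lim_transform_eventually)
    define w where "w = (\<Sum>i=1..k. (if i = 2 then \<tau> else 0) * h (k - i))"
    have y: "(\<lambda>n. (y1 n + y2 n) /\<^sub>R real n powr (real k / 2 - 1)) \<longlonglongrightarrow> w"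
      using tendsto_add[OF y1 y2] by (simp add: w_def scaleR_add_right)
    define L where "L = real k * b * inverse a"
    have Lr: "L + real k / 2 = real k * (a + 2 * b) / (2 * a)"
      using pos by (simp add: L_def field_simps)
    have "(\<lambda>n. fps_nth (F m n) k /\<^sub>R real n powr (real k / 2)) \<longlonglongrightarrow> w /\<^sub>R (L + real k / 2)"
    proof (rule linear_recurrence_asymptotics)
      show "fps_nth (F m (Suc n)) k = (1 - real k * b / M n) *\<^sub>R fps_nth (F m n) k + (y1 n + y2 n)" for n
        unfolding F_nth_recurrence[of m n k] y1_def y2_def T_def
        by (simp add: scaleR_conv_of_real N_eq real)
      show "(\<lambda>n. real n * (real k * b / M n)) \<longlonglongrightarrow> L"
        unfolding L_def M_def using pos by real_asymp
      show "0 < L + real k / 2" using pos k by (simp add: Lr)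
    qed (rule y)
    moreover have "w /\<^sub>R (L + real k / 2) = h k"
    \<comment> \<open>For \<open>k = 1\<close> there is no term \<open>i = 2\<close>, so
      \<open>w = 0\<close>.\<close>
    proof (cases "k = 1")
      case True
      then show ?thesis by (simp add: w_def h_def)
    next
      case False
      with k obtain j where j: "k = Suc (Suc j)" by (metis One_nat_def not0_implies_Suc)
      have "w = (\<Sum>i\<in>{2}. (if i = 2 then \<tau> else 0) * h (k - i))"
        unfolding w_def by (rule sum.mono_neutral_right) (auto simp: j)
      then have w: "w = \<tau> * h j" by (simp add: j numeral_2_eq_2)
      have hk: "h k = S * h j / of_nat k" by (simp add: h_def j)
      define c :: complex where "c = of_real (a + 2 * b)"
      have "c \<noteq> 0" unfolding c_def of_real_eq_0_iff using pos by simp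
      have \<tau>: "\<tau> = S * c / (2 * of_real a)" by (simp add: \<tau>_eq c_def)
      have Lk: "of_real (L + real k / 2) = of_nat k * c / (2 * of_real a)"
        by (simp add: Lr c_def del: of_real_add)
      have "w /\<^sub>R (L + real k / 2) = w / of_real (L + real k / 2)"
        by (simp only: scaleR_conv_of_real of_real_inverse divide_inverse mult.commute)
      also have "\<dots> = h k"
        unfolding Lk w \<tau> hk using pos k \<open>c \<noteq> 0\<close> by (simp add: field_simps)
      finally show ?thesis .
    qed
    ultimately show ?thesis by (simp add: h_def)
  qed
qed

end

section \<open>The limit law\<close>

text \<open>Division by \<open>s * sqrt n\<close> turns the hypothesis into convergence of all
  moments to the standard normal ones. This gives weak convergence, which is uniform because the
  limiting distribution function is continuous.\<close>

lemma central_limit_of_moments: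
  fixes M :: "nat \<Rightarrow> 'a measure" and Y :: "nat \<Rightarrow> 'a \<Rightarrow> real" and s :: real
  assumes "\<And>n. prob_space (M n)" and Y: "\<And>n. Y n \<in> borel_measurable (M n)" and s: "0 < s"
    and int: "\<And>n k. integrable (M n) (\<lambda>\<omega>. Y n \<omega> ^ k)"
    and lim: "\<And>k. (\<lambda>n. (LINT \<omega>|M n. Y n \<omega> ^ k) / real n powr (real k / 2))
      \<longlonglongrightarrow> s ^ k * (LINT x|std_normal_distribution. x ^ k)"
  shows "(\<lambda>n. SUP x. \<bar>measure (M n) {\<omega> \<in> space (M n). Y n \<omega> / (s * sqrt (real n)) \<le> x}
      - cdf std_normal_distribution x\<bar>) \<longlonglongrightarrow> 0"
proof -
  define Z where "Z n \<omega> = Y n \<omega> / (s * sqrt (real n))" for n \<omega>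
  define D where "D n = distr (M n) borel (Z n)" for n
  have Z[measurable]: "Z n \<in> borel_measurable (M n)" for n
    unfolding Z_def using Y by measurable
  have D: "real_distribution (D n)" for n
    using prob_space.real_distribution_distr[OF assms(1) Z] by (simp add: D_def)
  have Zk: "(\<lambda>\<omega>. Z n \<omega> ^ k) = (\<lambda>\<omega>. Y n \<omega> ^ k / (s * sqrt (real n)) ^ k)" for n k
    by (simp add: Z_def power_divide)
  have iD: "integrable (D n) (\<lambda>x. x ^ k)" for n k
    unfolding D_def by (subst integrable_distr_eq) (auto simp: Zk int)
  have "(LINT x|D n. x ^ k) = (LINT \<omega>|M n. Y n \<omega> ^ k) / (s * sqrt (real n)) ^ k" for n k
    unfolding D_def by (subst integral_distr) (auto simp: Zk)
  note mom = this
  have "(\<lambda>n. LINT x|D n. x ^ k) \<longlonglongrightarrow> (LINT x|std_normal_distribution. x ^ k)" for k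
  proof -
    have "(\<lambda>n. (LINT \<omega>|M n. Y n \<omega> ^ k) / real n powr (real k / 2) / s ^ k)
        \<longlonglongrightarrow> s ^ k * (LINT x|std_normal_distribution. x ^ k) / s ^ k"
      using s by (intro tendsto_divide lim tendsto_const) auto
    \<comment> \<open>At \<open>n = 0\<close> the two sides can differ: \<open>0 powr 0 = 0\<close>,
      but \<open>sqrt 0 ^ 0 = 1\<close>.\<close>
    moreover have "eventually (\<lambda>n. (LINT \<omega>|M n. Y n \<omega> ^ k) / real n powr (real k / 2) / s ^ k
        = (LINT x|D n. x ^ k)) sequentially"
      using eventually_gt_at_top[of 0]
    proof eventually_elim
      case (elim n)
      have "sqrt (real n) ^ k = real n powr (real k / 2)"
        using elim by (simp add: powr_half_sqrt [symmetric] powr_power)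
      then show ?case by (simp add: mom power_mult_distrib)
    qed
    ultimately have "(\<lambda>n. LINT x|D n. x ^ k)
        \<longlonglongrightarrow> s ^ k * (LINT x|std_normal_distribution. x ^ k) / s ^ k"
      by (rule Lim_transform_eventually)
    then show ?thesis using s by simp
  qed
  with D iD have "weak_conv_m D std_normal_distribution"
    by (rule moments_imp_weak_conv_std_normal)
  from weak_conv_m_imp_uniform_cdf[OF D real_dist_normal_dist this std_normal_isCont_cdf]
  have "(\<lambda>n. SUP x. \<bar>cdf (D n) x - cdf std_normal_distribution x\<bar>) \<longlonglongrightarrow> 0" .
  moreover have "cdf (D n) x = measure (M n) {\<omega> \<in> space (M n). Z n \<omega> \<le> x}" for n x
    unfolding D_def cdf_def by (subst measure_distr) (auto intro!: arg_cong[where f = "measure (M n)"])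
  ultimately show ?thesis by (simp add: Z_def)
qed

text \<open>The first centred moment is \<open>o(sqrt n)\<close>, so it is negligible against
  \<open>\<mu> * n\<close> and its square is negligible in the variance. Dividing by
  \<open>\<mu>\<close> requires \<open>\<mu> > 0\<close>, which is deduced from
  \<open>X n \<ge> 0\<close>.\<close>

lemma mean_variance_of_moments:
  fixes M :: "nat \<Rightarrow> 'a measure" and X :: "nat \<Rightarrow> 'a \<Rightarrow> real" and \<mu> s :: real
  assumes prob: "\<And>n. prob_space (M n)" and s: "0 < s"
    and nonneg: "\<And>n \<omega>. 0 \<le> X n \<omega>"
    and int: "\<And>n k. integrable (M n) (\<lambda>\<omega>. (X n \<omega> - \<mu> * real n) ^ k)"
    and lim: "\<And>k. (\<lambda>n. (LINT \<omega>|M n. (X n \<omega> - \<mu> * real n) ^ k) / real n powr (real k / 2))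
      \<longlonglongrightarrow> s ^ k * (LINT x|std_normal_distribution. x ^ k)"
  shows "(\<lambda>n. prob_space.expectation (M n) (X n) / (\<mu> * real n)) \<longlonglongrightarrow> 1"
    and "(\<lambda>n. prob_space.variance (M n) (X n) / (s\<^sup>2 * real n)) \<longlonglongrightarrow> 1"
proof -
  define E where "E n k = (LINT \<omega>|M n. (X n \<omega> - \<mu> * real n) ^ k)" for n k
  have ev: "eventually (\<lambda>n::nat. n > 0) sequentially" by (rule eventually_gt_at_top)
  have odd: "(\<lambda>n. E n k / real n powr (real k / 2)) \<longlonglongrightarrow> 0" if "odd k" for k
    using lim[of k] that by (simp add: E_def integral_std_normal_distribution_moment_odd)
  have "(\<lambda>n. E n 2 / real n powr (real 2 / 2)) \<longlonglongrightarrow> s\<^sup>2"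
    using lim[of 2] std_normal_distribution_even_moments(1)[of 1] by (simp add: E_def)
  then have l2: "(\<lambda>n. E n 2 / real n) \<longlonglongrightarrow> s\<^sup>2" by simp
  have E1: "(LINT \<omega>|M n. X n \<omega> - \<mu> * real n) = E n 1" for n by (simp add: E_def)
  have X_int: "integrable (M n) (X n)" for n
  proof -
    interpret prob_space "M n" by (rule prob)
    have "integrable (M n) (\<lambda>\<omega>. (X n \<omega> - \<mu> * real n) ^ 1 + \<mu> * real n)"
      by (intro Bochner_Integration.integrable_add int) auto
    then show ?thesis by simp
  qed
  have mean: "prob_space.expectation (M n) (X n) = E n 1 + \<mu> * real n" for n
  proof -
    interpret prob_space "M n" by (rule prob)
    show ?thesis using X_int[of n] by (simp add: E_def prob_space)
  qed
  have var: "prob_space.variance (M n) (X n) = E n 2 - (E n 1)\<^sup>2" for n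
  proof -
    interpret prob_space "M n" by (rule prob)
    let ?Y = "\<lambda>\<omega>. X n \<omega> - \<mu> * real n"
    have i: "integrable (M n) ?Y" "integrable (M n) (\<lambda>\<omega>. ?Y \<omega> ^ 2)"
      using int[of n 1] int[of n 2] by simp_all
    have "variance (X n) = (LINT \<omega>|M n. (?Y \<omega>)\<^sup>2 - 2 * E n 1 * ?Y \<omega> + (E n 1)\<^sup>2)"
      unfolding mean by (intro Bochner_Integration.integral_cong refl) (simp add: power2_eq_square algebra_simps)
    also have "\<dots> = (LINT \<omega>|M n. (?Y \<omega>)\<^sup>2) - 2 * E n 1 * (LINT \<omega>|M n. ?Y \<omega>) + (E n 1)\<^sup>2"
      using i by (simp add: prob_space)
    also have "\<dots> = E n 2 - (E n 1)\<^sup>2"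
      unfolding E1 by (simp add: E_def power2_eq_square)
    finally show ?thesis .
  qed
  have "0 < \<mu>"
  proof (rule ccontr)
    assume "\<not> 0 < \<mu>"
    \<comment> \<open>For \<open>y \<ge> 0\<close> one has \<open>2 y\<^sup>2 \<le> y + y\<^sup>3\<close>; a centred limit of nonnegative variables whose
      first and third moments vanish would thus have vanishing second moment.\<close>
    have "2 * (E n 2 / real n) \<le> E n 1 / real n powr (real 1 / 2) + E n 3 / real n powr (real 3 / 2)"
      if n: "n > 0" for n
    proof -
      interpret prob_space "M n" by (rule prob)
      let ?r = "real n powr (1 / 2)"
      let ?Y = "\<lambda>\<omega>. X n \<omega> - \<mu> * real n"
      have r: "?r > 0" "real n = ?r ^ 2" "real n powr (3 / 2) = ?r ^ 3"
        using n by (simp_all add: powr_power)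
      have pt: "2 * (?Y \<omega> ^ 2 / real n) \<le> ?Y \<omega> ^ 1 / ?r + ?Y \<omega> ^ 3 / real n powr (3 / 2)" for \<omega>
      proof -
        define y where "y = ?Y \<omega> / ?r"
        have "0 \<le> y" using \<open>\<not> 0 < \<mu>\<close> nonneg[of n \<omega>] r(1)
          by (auto simp: y_def intro!: divide_nonneg_pos add_nonneg_nonneg mult_nonpos_nonneg)
             (smt (verit) mult_nonpos_nonneg of_nat_0_le_iff)
        then have "0 \<le> y * (y - 1)\<^sup>2" by simp
        then have "2 * y ^ 2 \<le> y ^ 1 + y ^ 3"
          by (simp add: power2_eq_square power3_eq_cube algebra_simps)
        then show ?thesis unfolding y_def power_divide r(3) r(2)[symmetric] by simp
      qed
      have "(LINT \<omega>|M n. 2 * (?Y \<omega> ^ 2 / real n)) \<le> (LINT \<omega>|M n. ?Y \<omega> ^ 1 / ?r + ?Y \<omega> ^ 3 / real n powr (3 / 2))"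
        by (intro integral_mono pt Bochner_Integration.integrable_add integrable_mult_right integrable_divide int)
      then show ?thesis
        using int[of n 1] int[of n 2] int[of n 3] by (simp add: E_def)
    qed
    then have "eventually (\<lambda>n. 2 * (E n 2 / real n) \<le> E n 1 / real n powr (real 1 / 2) + E n 3 / real n powr (real 3 / 2)) sequentially"
      by (rule eventually_mono[OF ev])
    \<comment> \<open>In the limit the inequality reads
      \<open>2 * s\<^sup>2 \<le> 0\<close>.\<close>
    from tendsto_le[OF _ tendsto_add[OF odd odd] tendsto_mult[OF tendsto_const l2] this]
    show False using s by simp
  qed
  have l1: "(\<lambda>n. E n 1 / real n powr (1 / 2)) \<longlonglongrightarrow> 0" using odd[of 1] by simp
  have "(\<lambda>n. E n 1 / real n powr (1 / 2) * (real n powr (- 1 / 2) / \<mu>) + 1) \<longlonglongrightarrow> 0 * (0 / \<mu>) + 1"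
  proof (intro tendsto_intros l1)
    show "(\<lambda>n. real n powr (- 1 / 2)) \<longlonglongrightarrow> 0" by real_asymp
  qed (use \<open>0 < \<mu>\<close> in auto)
  moreover have "eventually (\<lambda>n. E n 1 / real n powr (1 / 2) * (real n powr (- 1 / 2) / \<mu>) + 1
      = prob_space.expectation (M n) (X n) / (\<mu> * real n)) sequentially"
    using ev
  proof eventually_elim
    case (elim n)
    have "real n powr (- 1 / 2) / real n powr (1 / 2) = 1 / real n"
      using elim by (simp add: powr_minus_divide powr_half_sqrt)
    moreover have "E n 1 / real n powr (1 / 2) * (real n powr (- 1 / 2) / \<mu>)
        = E n 1 / \<mu> * (real n powr (- 1 / 2) / real n powr (1 / 2))"
      by (simp add: mult.commute)
    ultimately have "E n 1 / real n powr (1 / 2) * (real n powr (- 1 / 2) / \<mu>) = E n 1 / \<mu> * (1 / real n)"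
      by simp
    then show ?case
      unfolding mean using elim \<open>0 < \<mu>\<close> by (simp add: add_divide_distrib)
  qed
  ultimately show "(\<lambda>n. prob_space.expectation (M n) (X n) / (\<mu> * real n)) \<longlonglongrightarrow> 1"
    by (auto intro: Lim_transform_eventually)
  have "(\<lambda>n. (E n 2 / real n - (E n 1 / real n powr (1 / 2))\<^sup>2) / s\<^sup>2) \<longlonglongrightarrow> (s\<^sup>2 - 0\<^sup>2) / s\<^sup>2"
    by (intro tendsto_intros l1 l2) (use s in auto)
  moreover have "(E n 1 / real n powr (1 / 2))\<^sup>2 = (E n 1)\<^sup>2 / real n" for n
    by (simp add: power_divide powr_half_sqrt)
  ultimately show "(\<lambda>n. prob_space.variance (M n) (X n) / (s\<^sup>2 * real n)) \<longlonglongrightarrow> 1"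
    using s unfolding var by (simp add: diff_divide_distrib mult.commute)
qed

section \<open>From the analytic data to the random variables\<close>

theorem mainTheorem1:
  fixes \<alpha> \<beta> \<gamma> P\<^sub>0 :: "complex \<Rightarrow> complex"
    and P :: "nat \<Rightarrow> complex \<Rightarrow> complex"
    and \<mu> \<sigma>2 :: complex
    and M :: "nat \<Rightarrow> 'a measure"
    and X :: "nat \<Rightarrow> 'a \<Rightarrow> nat"
  defines "P \<equiv> eulerian_seq \<alpha> \<beta> \<gamma> P\<^sub>0"
    and "\<mu> \<equiv> eulerian_mu \<alpha> \<beta>"
    and "\<sigma>2 \<equiv> eulerian_sigma2 \<alpha> \<beta>"
  assumes "\<alpha> analytic_on cball 0 1"
    and "\<beta> analytic_on cball 0 1"
    and "\<gamma> analytic_on cball 0 1"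
    and "P\<^sub>0 analytic_on cball 0 1"
    and "\<And>n k. 0 \<le> fps_nth (fps_expansion (P n) 0) k"
    and "\<And>n. \<exists>v\<in>cball 0 1. P n v \<noteq> 0"
    and "0 < \<alpha> 1"
    and "0 < \<alpha> 1 + 2 * \<beta> 1"
    and "0 < \<sigma>2"
    and "\<And>n. prob_space (M n)"
    and "\<And>n. X n \<in> measurable (M n) (count_space UNIV)"
    and "\<And>n k. complex_of_real (measure (M n) {\<omega> \<in> space (M n). X n \<omega> = k})
                 = fps_nth (fps_expansion (P n) 0) k / P n 1"
  shows "(\<lambda>n. complex_of_real (prob_space.expectation (M n) (\<lambda>\<omega>. real (X n \<omega>))))
           \<sim>[sequentially] (\<lambda>n. \<mu> * of_nat n)
       \<and> (\<lambda>n. complex_of_real (prob_space.variance (M n) (\<lambda>\<omega>. real (X n \<omega>))))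
           \<sim>[sequentially] (\<lambda>n. \<sigma>2 * of_nat n)
       \<and> (\<lambda>n. SUP x::real.
            \<bar>measure (M n) {\<omega> \<in> space (M n).
                (real (X n \<omega>) - Re \<mu> * real n) / (sqrt (Re \<sigma>2) * sqrt (real n)) \<le> x}
             - cdf std_normal_distribution x\<bar>) \<longlonglongrightarrow> 0"
proof -
  note analytic = assms(4-7) and coeffs = assms(8) and \<alpha>_pos = assms(10) and \<alpha>\<beta>_pos = assms(11)
    and \<sigma>2_pos = assms(12) and prob = assms(13) and X_meas = assms(14) and dist = assms(15)
  define q where "q n k = measure (M n) {\<omega> \<in> space (M n). X n \<omega> = k}" for n k
  have q0: "0 \<le> q n k" for n k by (simp add: q_def)
  have q_sums: "q n sums 1" if "summable (q n)" for n
    using nat_valued_expectation(2)[OF prob X_meas, of "\<lambda>_. 1" n] that prob_space.prob_space[OF prob]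
    by (simp add: q_def[abs_def])
  \<comment> \<open>If \<open>P n 1\<close> were 0, division by zero would yield 0 and every
    probability would vanish, contradicting total mass one.\<close>
  have P1: "P n 1 \<noteq> 0" for n
  proof
    assume "P n 1 = 0"
    then have "q n k = 0" for k using dist[of n k] by (simp add: q_def)
    then have "q n = (\<lambda>_. 0)" by auto
    with q_sums[of n] have "(\<lambda>_. 0 :: real) sums 1" by simp
    from sums_unique2[OF this sums_zero] show False by simp
  qed
  obtain R1 R2 R3 R4 where Ri: "1 < R1" "\<alpha> holomorphic_on ball 0 R1" "1 < R2" "\<beta> holomorphic_on ball 0 R2"
    "1 < R3" "\<gamma> holomorphic_on ball 0 R3" "1 < R4" "P\<^sub>0 holomorphic_on ball 0 R4"
    using analytic[THEN analytic_on_unit_disc_imp_holomorphic_on_ball] by metis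
  define R where "R = min (min R1 R2) (min R3 R4)"
  interpret eulerian_recurrence \<alpha> \<beta> \<gamma> P\<^sub>0 R
  proof
    show "eulerian_seq \<alpha> \<beta> \<gamma> P\<^sub>0 n 1 \<noteq> 0" for n using P1 by (simp add: P_def)
  qed (use Ri in \<open>auto simp: R_def intro: holomorphic_on_subset\<close>)
  note [simp] = P_def[symmetric]
  \<comment> \<open>Evaluating the series at 1 expresses the moments about \<open>m * n\<close>, for
    a possibly complex \<open>m\<close>, by Taylor coefficients.\<close>
  have centred: "(\<lambda>j. (of_nat j - m * of_nat n) ^ k * complex_of_real (q n j)) sums (fact k * fps_nth (F m n) k)" for m n k
  proof -
    have "(\<lambda>j. (of_nat j - m * of_nat n) ^ k * fps_nth (fps_expansion (P n) 0) j / P n 1) sums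
        ((euler_op (m * of_nat n) ^^ k) (P n) 1 / P n 1)"
      using R unfolding P_def by (intro sums_divide power_sums_euler_op[OF P_holomorphic])
    then show ?thesis using dist by (simp add: q_def F_nth)
  qed
  have "q n sums 1" for n
  proof -
    from sums_Re[OF centred[of 0 n 0]] show ?thesis by (simp add: F_nth_0)
  qed
  note q_sums = this
  have P_real: "P n 1 \<in> \<real>" for n
  proof -
    have "(\<lambda>j. fps_nth (fps_expansion (P n) 0) j) sums P n 1"
      using power_sums_euler_op[OF P_holomorphic R, of 0 0 n] by simp
    from sums_Im[OF this] coeffs[of n] have "(\<lambda>_. 0) sums Im (P n 1)"
      by (simp add: less_eq_complex_def)
    from sums_unique2[OF this sums_zero] show ?thesis by (simp add: complex_is_Real_iff)
  qed
  \<comment> \<open>Being a ratio of real values, \<open>N n\<close> is real; the case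
    \<open>n = 0\<close> then shows that \<open>\<gamma> 1\<close> is real, since
    \<open>\<alpha> 1\<close> is.\<close>
  have "N n \<in> \<real>" for n
  proof -
    have "N n = P (Suc n) 1 / P n 1" using P_Suc_1[of n] P1[of n] by simp
    then show ?thesis using P_real by simp
  qed
  define a b g where "a = Re (\<alpha> 1)" and "b = Re (\<beta> 1)" and "g = Re (\<gamma> 1)"
  have a: "\<alpha> 1 = of_real a" "0 < a" using \<alpha>_pos by (auto simp: a_def less_complex_def complex_eq_iff)
  have b: "\<beta> 1 = of_real b" "0 < a + 2 * b"
    using \<alpha>\<beta>_pos unfolding a(1) by (auto simp: b_def less_complex_def complex_eq_iff)
  have g: "\<gamma> 1 = of_real g"
    using \<open>N 0 \<in> \<real>\<close> a by (auto simp: g_def N_def complex_is_Real_iff complex_eq_iff)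
  \<comment> \<open>For the first part, \<open>2 * (a + b) = a + (a + 2 * b)\<close> is
    positive.\<close>
  have ab: "\<alpha> 1 + \<beta> 1 \<noteq> 0" "\<alpha> 1 + 2 * \<beta> 1 \<noteq> 0"
    using a b by (auto simp: complex_eq_iff)
  have \<mu>_eq: "\<mu> * (\<alpha> 1 + \<beta> 1) = deriv \<alpha> 1"
    using ab by (simp add: \<mu>_def eulerian_mu_def)
  have \<sigma>2_eq: "\<sigma>2 * (\<alpha> 1 + 2 * \<beta> 1) = \<mu> * (\<alpha> 1 + 2 * \<beta> 1)
      + ((deriv ^^ 2) \<alpha> 1 - 2 * \<mu> * deriv \<beta> 1 - \<alpha> 1 * \<mu>\<^sup>2)"
    using ab by (simp add: \<sigma>2_def eulerian_sigma2_def \<mu>_def distrib_right)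
  note F_lim = F_nth_limit[OF a(1) b(1) g a(2) b(2) \<mu>_eq \<sigma>2_eq]

  \<comment> \<open>The first moment about \<open>\<mu> * n\<close> has imaginary part
    \<open>- Im \<mu> * n\<close>, yet it is \<open>o(sqrt n)\<close>.\<close>
  have "Im \<mu> = 0"
  proof -
    have Im_F: "Im (fps_nth (F \<mu> n) 1) = - (Im \<mu> * real n)" for n
    proof -
      have "(\<lambda>j. - (Im \<mu> * real n) * q n j) sums Im (fps_nth (F \<mu> n) 1)"
        using sums_Im[OF centred[of \<mu> n 1]] by simp
      moreover have "(\<lambda>j. - (Im \<mu> * real n) * q n j) sums (- (Im \<mu> * real n) * 1)"
        by (intro sums_mult q_sums)
      ultimately have "Im (fps_nth (F \<mu> n) 1) = - (Im \<mu> * real n) * 1" by (rule sums_unique2)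
      then show ?thesis by simp
    qed
    have Im_scale: "Im (z /\<^sub>R r) = Im z / r" for z r
      by (simp only: scaleR_complex.sel divide_inverse mult.commute)
    have "(\<lambda>n. - (Im \<mu> * real n) / real n powr (1 / 2)) \<longlonglongrightarrow> 0"
      using tendsto_Im[OF F_lim[of 1]] unfolding Im_scale Im_F by simp
    moreover have "(\<lambda>n. real n powr (- 1 / 2)) \<longlonglongrightarrow> 0" by real_asymp
    ultimately have "(\<lambda>n. - (Im \<mu> * real n) / real n powr (1 / 2) * real n powr (- 1 / 2)) \<longlonglongrightarrow> 0 * 0"
      by (rule tendsto_mult)
    moreover have "eventually (\<lambda>n. - (Im \<mu> * real n) / real n powr (1 / 2) * real n powr (- 1 / 2) = - Im \<mu>) sequentially"
      using eventually_gt_at_top[of 0]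
    proof eventually_elim
      case (elim n)
      have "real n powr (- 1 / 2) / real n powr (1 / 2) = 1 / real n"
        using elim by (simp add: powr_minus_divide powr_half_sqrt)
      then show ?case using elim by (simp add: field_simps)
    qed
    ultimately have "(\<lambda>n::nat. - Im \<mu>) \<longlonglongrightarrow> 0" by (auto intro: Lim_transform_eventually)
    then show ?thesis by (simp add: LIMSEQ_const_iff)
  qed
  then have \<mu>_real: "\<mu> = of_real (Re \<mu>)" by (simp add: complex_eq_iff)
  define s where "s = sqrt (Re \<sigma>2)"
  have s: "0 < s" "\<sigma>2 = of_real (s\<^sup>2)"
    using \<sigma>2_pos by (auto simp: s_def less_complex_def complex_eq_iff)

  define h where "h n k j = (real j - Re \<mu> * real n) ^ k" for n k j
  have h_sums: "(\<lambda>j. h n k j * q n j) sums Re (fact k * fps_nth (F \<mu> n) k)" for n k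
  proof -
    have "(of_nat j - \<mu> * of_nat n) ^ k * complex_of_real (q n j) = of_real (h n k j * q n j)" for j
      unfolding h_def by (subst \<mu>_real) simp
    with sums_Re[OF centred[of \<mu> n k]] show ?thesis by simp
  qed
  \<comment> \<open>By \<open>\<bar>x\<bar> \<le> 1 + x\<^sup>2\<close> the absolute moment of order
    \<open>k\<close> is dominated by the moments of orders 0 and \<open>2 * k\<close>, whose series
    are known to converge.\<close>
  have "summable (\<lambda>j. \<bar>h n k j\<bar> * q n j)" for n k
  proof (rule summable_comparison_test')
    show "summable (\<lambda>j. q n j + h n (2 * k) j * q n j)"
      using q_sums h_sums by (intro summable_add) (auto simp: sums_iff)
    fix j
    have "\<bar>x\<bar> \<le> 1 + x\<^sup>2" for x :: real
      using zero_le_power2[of "\<bar>x\<bar> - 1"] by (simp add: power2_diff)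
    from this[of "h n k j"] have "\<bar>h n k j\<bar> \<le> 1 + h n (2 * k) j"
      by (simp add: h_def power_even_eq)
    then have "\<bar>h n k j\<bar> * q n j \<le> (1 + h n (2 * k) j) * q n j"
      by (rule mult_right_mono) (rule q0)
    then show "norm (\<bar>h n k j\<bar> * q n j) \<le> q n j + h n (2 * k) j * q n j"
      using q0[of n j] by (simp add: distrib_right abs_mult)
  qed
  note expect = nat_valued_expectation[OF prob X_meas this[unfolded q_def], folded q_def, unfolded h_def]
  have int: "integrable (M n) (\<lambda>\<omega>. (real (X n \<omega>) - Re \<mu> * real n) ^ k)" for n k
    by (rule expect(1))
  have moment: "(LINT \<omega>|M n. (real (X n \<omega>) - Re \<mu> * real n) ^ k) = Re (fact k * fps_nth (F \<mu> n) k)" for n k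
    using expect(2)[of n k] h_sums[of n k] unfolding h_def by (rule sums_unique2)
  have Re_scale: "Re (c * (z /\<^sub>R r)) = Re (c * z) / r" for c z r
    by (simp only: mult_scaleR_right scaleR_complex.sel divide_inverse mult.commute)
  have "(LINT \<omega>|M n. (real (X n \<omega>) - Re \<mu> * real n) ^ k) / real n powr (real k / 2)
      = Re (fact k * (fps_nth (F \<mu> n) k /\<^sub>R real n powr (real k / 2)))" for n k
    unfolding moment Re_scale ..
  moreover have "(\<lambda>n. Re (fact k * (fps_nth (F \<mu> n) k /\<^sub>R real n powr (real k / 2))))
      \<longlonglongrightarrow> Re (fact k * gaussian_coeff \<sigma>2 k)" for k
    by (intro tendsto_intros F_lim)
  moreover have "Re (fact k * gaussian_coeff \<sigma>2 k) = s ^ k * (LINT x|std_normal_distribution. x ^ k)" for k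
    unfolding s(2) gaussian_coeff_eq_moment by simp
  ultimately have lim: "(\<lambda>n. (LINT \<omega>|M n. (real (X n \<omega>) - Re \<mu> * real n) ^ k) / real n powr (real k / 2))
      \<longlonglongrightarrow> s ^ k * (LINT x|std_normal_distribution. x ^ k)" for k
    by simp
  note mv = mean_variance_of_moments[of M s "\<lambda>n \<omega>. real (X n \<omega>)", OF prob s(1) _ int lim]
  have asymp: "(\<lambda>n. complex_of_real (f n)) \<sim>[sequentially] (\<lambda>n. z * of_nat n)"
    if "(\<lambda>n. f n / (c * real n)) \<longlonglongrightarrow> 1" "z = of_real c" for f :: "nat \<Rightarrow> real" and z c
  proof (rule asymp_equivI')
    show "(\<lambda>n. complex_of_real (f n) / (z * of_nat n)) \<longlonglongrightarrow> 1"
      using tendsto_of_real[OF that(1), where 'a = complex] unfolding that(2) by simp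
  qed
  have [measurable]: "X n \<in> measurable (M n) (count_space UNIV)" for n by (rule X_meas)
  have "(\<lambda>\<omega>. real (X n \<omega>) - Re \<mu> * real n) \<in> borel_measurable (M n)" for n by measurable
  from central_limit_of_moments[OF prob this s(1) int lim]
  show ?thesis
    using asymp[OF mv(1) \<mu>_real] asymp[OF mv(2) s(2)] by (simp add: s_def)
qed

end
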